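(* Let $A$ be a Büchi alternating automaton on $k$-ary $\Sigma(x,N_P,N_{cF})$-trees, $Q$ its set of states, and $F\subseteq Q$ its set of accepting states. There exists a Büchi nondeterministic automaton on $k$-ary $\Sigma(x,N_P,N_{cF})$-trees simulating $A$ (i.e., accepting the same language as $A$) whose number of states is bounded by $\left(\frac{2}{3}\right)^{|F|}3^{|Q|}+1$.
   Context: **Concrete domain.** $x$ is a $p$-ary spatial relation algebra: it has a finite set of atoms, which are jointly exhaustive and pairwise disjoint $p$-ary relations on a set $\Delta_{D_x}$ of spatial objects; an $x$ relation is a set of atoms, interpreted as their union; satisfiability of finite conjunctions of atomic constraints is decidable. (Examples: RCC8 over regions of a topological space, the cardinal direction algebra over 2D points, the ternary algebra $CYC_t$ over 2D orientations.) **Alphabets.** $K=\{d_1,\dots,d_k\}$, $k\ge 1$, is a set of directions; $N_P$ is a set of primitive concepts (atomic propositions); $N_{cF}$ is a finite set of concrete features. $\Theta(N_{cF},\Delta_{D_x})$ is the set of total functions $N_{cF}\to\Delta_{D_x}$, and $\Sigma(x,N_P,N_{cF})=2^{N_P}\times\Theta(N_{cF},\Delta_{D_x})$. $Lit(N_P)=N_P\cup\{\neg A: A\in N_P\}$; $c(2^{Lit(N_P)})$ is the set of $S\subseteq Lit(N_P)$ containing no pair $\{A,\neg A\}$. $Constr(x,K,N_{cF})$ is the set of constraints $P(u_1,\dots,u_p)$ with $P$ an $x$ relation and each $u_i\in K^*N_{cF}$ (a finite word of directions followed by a concrete feature). **Trees.** A (full) $k$-ary $\Sigma$-tree is a map $t:K^*\to\Sigma$;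 a partial $k$-ary $\Sigma$-tree is a partial map $K^*\to\Sigma$ with prefix-closed domain. The root is $\epsilon$, and $ud$ is the $d$-successor of $u$. The level of a node is its length. If $t$ is a $\Sigma(x,N_P,N_{cF})$-tree, write $t(u)=(P_u,\theta_u)$. Say that $t$ *satisfies* $(L,X)$ at $u$, for $L\in c(2^{Lit(N_P)})$ and $X\subseteq Constr(x,K,N_{cF})$, if for all $A'\in N_P$, $A'\in L$ implies $A'\in P_u$ and $\neg A'\in L$ implies $A'\notin P_u$, and for every $P(w_1g_1,\dots,w_pg_p)\in X$ ($w_i\in K^*$, $g_i\in N_{cF}$), $P(\theta_{uw_1}(g_1),\dots,\theta_{uw_p}(g_p))$ holds. **Alternating automaton.** $\mathcal L(S)$ denotes the free distributive lattice generated by $S$ (formulas built from elements of $S$ with $\wedge,\vee$, without negation). A Büchi alternating automaton on $k$-ary $\Sigma(x,N_P,N_{cF})$-trees consists of a finite set $Q$ of states, an initial state $q_0\in Q$, a set $F\subseteq Q$ of accepting states, and a transition function $\delta:Q\to\mathcal L(Lit(N_P)\cup Constr(x,K,N_{cF})\cup (K\times Q))$. **Histories and runs (alternating).** $H_n=\{q_0\}(KQ)^n$ is the set of $n$-histories $h=q_0d_{i_1}q_{i_1}\cdots d_{i_n}q_{i_n}$; $Last(h)$ is $q_0$ if $n=0$ and $q_{i_n}$ otherwise; $H_{fin}=\bigcup_n H_n$. For $h\in H_{fin}$, $dist(h,e_1)$ is obtained from $e_1\in\mathcal L(Lit(N_P)\cup Constr(x,K,N_{cF})\cup(K\times Q))$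 by replacing each generator $(d,q)$ by the history $hdq$, leaving literals and constraints unchanged and commuting with $\vee,\wedge$. A run of $A$ on $t$ is a partial $k$-ary tree $\sigma$ labelled in $2^{H_{fin}}\times c(2^{Lit(N_P)})\times 2^{Constr(x,K,N_{cF})}$, with labels $(Y_u,L_u,X_u)$, such that $Y_\epsilon=\{q_0\}$ and, for each node $u$ of level $n$, writing $\bigwedge_{h\in Y_u}dist(h,\delta(Last(h)))$ in disjunctive normal form as $\bigvee_{i=1}^r(L_i\wedge X_i\wedge Y_i)$ (conjunctions of literals, of constraints and of $(n+1)$-histories respectively), there is $i$ such that $L_u$ is the set of literals occurring in $L_i$; $X_u$ is the set of constraints occurring in $X_i$; $u$ has a $d$-successor exactly for those $d\in K$ for which the set of $hdq\in H_{n+1}$ ($h\in H_n$, $q\in Q$) occurring in $Y_i$ is nonempty, and $Y_{ud}$ is then that set; and $t$ satisfies $(L_u,X_u)$ at $u$. A branch of $\sigma$ is an infinite path from the root. An infinite history $q_0d_{i_1}q_{i_1}d_{i_2}q_{i_2}\cdots$ lies along a branch $\beta$ if for every $n\geq 1$ its $n$-history prefix belongs to $Y_u$, $u$ being the node of $\beta$ of level $n$; it is accepting if some state of $F$ occurs infinitely often in $q_0q_{i_1}q_{i_2}\cdots$. A branch is accepting if every history lying along it is accepting. **Nondeterministic automaton.** A Büchi nondeterministic automaton $B$ on $k$-ary $\Sigma(x,N_P,N_{cF})$-trees consists of a finite set $Q_B$ of states, an initial state $q_0^B\in Q_B$, a set $F_B\subseteq Q_B$, an accept-all state $q_\#\in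 F_B$, and a transition function $\delta_B$ assigning to each $q\in Q_B$ a subset of $2^{Lit(N_P)}\times 2^{Constr(x,K,N_{cF})}\times Q_B^k$, with $\delta_B(q_\#)=\{(\emptyset,\emptyset,(q_\#,\dots,q_\#))\}$. A run of $B$ on $t$ is a full $k$-ary tree labelled in $Q_B\times c(2^{Lit(N_P)})\times 2^{Constr(x,K,N_{cF})}$, with labels $(Y_u,L_u,X_u)$, such that $Y_\epsilon=q_0^B$ and for each node $u$ there is $(L,X,(q_{i_1},\dots,q_{i_k}))\in\delta_B(Y_u)$ with $L_u=L$, $X_u=X$, $Y_{ud_j}=q_{i_j}$ for $j=1,\dots,k$, and $t$ satisfies $(L_u,X_u)$ at $u$. A branch (infinite path from the root) of such a run is accepting if some state of $F_B$ occurs infinitely often as $Y_u$ along it. **Acceptance (both kinds).** The CSP of a run $\sigma$ has, for each node $v$ and each $P(w_1g_1,\dots,w_pg_p)\in X_v$, the variables $\langle vw_i,g_i\rangle$ and the constraint $P(\langle vw_1,g_1\rangle,\dots,\langle vw_p,g_p\rangle)$; it is consistent if there is an assignment of elements of $\Delta_{D_x}$ to its variables satisfying all its constraints. A run is accepting if all its branches are accepting and its CSP is consistent. An automaton accepts $t$ if it has an accepting run on $t$; its language is the set of all $k$-ary $\Sigma(x,N_P,N_{cF})$-trees it accepts. *)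

theory Defs
  imports Complex_Main "HOL-Library.FuncSet" "HOL-Library.Nat_Bijection"
begin

section \<open>Decidability\<close>

text \<open>Partial recursive functions on tuples of naturals. In \<open>Primrec f g\<close> and \<open>Mu f\<close> the
  recursion (search) argument comes first.\<close>

datatype recfun =
    Zero
  | Succ
  | Proj nat
  | Comp recfun "recfun list"
  | Primrec recfun recfun
  | Mu recfun

inductive computes :: "recfun \<Rightarrow> nat list \<Rightarrow> nat \<Rightarrow> bool" where
  zero: "computes Zero xs 0"
| succ: "computes Succ [n] (Suc n)"
| proj: "i < length xs \<Longrightarrow> computes (Proj i) xs (xs ! i)"
| comp: "list_all2 (\<lambda>g y. computes g xs y) gs ys \<Longrightarrow> computes f ys z \<Longrightarrow> computes (Comp f gs) xs z"
| primrec_0: "computes f xs y \<Longrightarrow> computes (Primrec f g) (0 # xs) y"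
| primrec_Suc: "computes (Primrec f g) (n # xs) y \<Longrightarrow> computes g (n # y # xs) z \<Longrightarrow>
    computes (Primrec f g) (Suc n # xs) z"
| mu: "computes f (n # xs) 0 \<Longrightarrow> (\<And>m. m < n \<Longrightarrow> \<exists>y > 0. computes f (m # xs) y) \<Longrightarrow>
    computes (Mu f) xs n"

lemma computes_deterministic:
  "computes f xs y \<Longrightarrow> computes f xs z \<Longrightarrow> y = z"
proof (induction arbitrary: z rule: computes.induct)
  case (comp xs gs ys f z')
  from comp.prems obtain ys' where ys': "list_all2 (\<lambda>g y. computes g xs y) gs ys'"
    and z: "computes f ys' z"
    by (rule computes.cases) simp_all
  have "ys = ys'"
    using comp.IH(1) ys' by (simp add: list_all2_conv_all_nth list_eq_iff_nth_eq)
  with z comp.IH(2) show ?case by simp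
next
  case (primrec_Suc f g n xs y z')
  from primrec_Suc.prems obtain y' where "computes (Primrec f g) (n # xs) y'"
    "computes g (n # y' # xs) z"
    by (rule computes.cases) simp_all
  with primrec_Suc.IH show ?case by blast
next
  case (mu f n xs)
  from mu.prems have z: "computes f (z # xs) 0 \<and> (\<forall>m < z. \<exists>y > 0. computes f (m # xs) y)"
    by (rule computes.cases) simp_all
  show ?case
  proof (rule linorder_cases[of n z])
    assume "n < z"
    then show ?thesis using z mu.IH(1) by (metis less_irrefl)
  next
    assume "z < n"
    then show ?thesis using z mu.IH(2) by (metis less_irrefl)
  qed
qed (erule computes.cases; simp)+


section \<open>Spatial relation algebras\<close>

text \<open>A \<open>p\<close>-ary relation is a set of lists of length \<open>p\<close>. A relation of the algebra is a set of
  atoms, hence a set of sets of lists, and is interpreted as its union.\<close>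

record 'o spatial_algebra =
  objects :: "'o set"
  arity :: nat
  atoms :: "'o list set set"

definition tuples :: "'o spatial_algebra \<Rightarrow> 'o list set" where
  "tuples x = {os. length os = arity x \<and> set os \<subseteq> objects x}"

text \<open>Relative to an enumeration \<open>as\<close> of the atoms, the pair \<open>(i, vs)\<close> stands for the atomic
  constraint \<open>(as ! i)(vs)\<close> over variables named by naturals. Since atoms only relate objects of
  the algebra, a solution \<open>\<nu>\<close> takes all variables that occur to such objects.\<close>

type_synonym atomic_conj = "(nat \<times> nat list) list"

definition atomic_conjs :: "'o spatial_algebra \<Rightarrow> 'o list set list \<Rightarrow> atomic_conj set" where
  "atomic_conjs x as = {c. \<forall>(i, vs) \<in> set c. i < length as \<and> length vs = arity x}"

definition satisfiable_conj :: "'o list set list \<Rightarrow> atomic_conj \<Rightarrow> bool" where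
  "satisfiable_conj as c \<longleftrightarrow> (\<exists>\<nu>. \<forall>(i, vs) \<in> set c. map \<nu> vs \<in> as ! i)"

definition code_conj :: "atomic_conj \<Rightarrow> nat" where
  "code_conj c = list_encode (map (\<lambda>(i, vs). prod_encode (i, list_encode vs)) c)"

definition decidable_algebra :: "'o spatial_algebra \<Rightarrow> bool" where
  "decidable_algebra x \<longleftrightarrow>
    (\<exists>as f. distinct as \<and> set as = atoms x \<and>
      (\<forall>c \<in> atomic_conjs x as. computes f [code_conj c] (if satisfiable_conj as c then 1 else 0)))"

definition spatial_relation_algebra :: "'o spatial_algebra \<Rightarrow> bool" where
  "spatial_relation_algebra x \<longleftrightarrow>
    finite (atoms x) \<and> pairwise disjnt (atoms x) \<and> \<Union>(atoms x) = tuples x \<and> decidable_algebra x"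


section \<open>Literals, constraints and trees\<close>

text \<open>The directions are the elements of a finite type \<open>'d\<close>, so \<open>K\<^sup>*\<close> is \<open>'d list\<close> and the
  \<open>d\<close>-successor of \<open>u\<close> is \<open>u @ [d]\<close>.\<close>

datatype 'a lit = Pos 'a | Neg 'a

definition Lit :: "'a set \<Rightarrow> 'a lit set" where
  "Lit NP = Pos ` NP \<union> Neg ` NP"

definition consistent_lits :: "'a set \<Rightarrow> 'a lit set set" where
  "consistent_lits NP = {S. S \<subseteq> Lit NP \<and> \<not> (\<exists>A. Pos A \<in> S \<and> Neg A \<in> S)}"

type_synonym ('o, 'd, 'f) constr = "'o list set set \<times> ('d list \<times> 'f) list"

definition Constr :: "'o spatial_algebra \<Rightarrow> 'f set \<Rightarrow> ('o, 'd, 'f) constr set" where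
  "Constr x NcF = {(P, us). P \<subseteq> atoms x \<and> length us = arity x \<and> snd ` set us \<subseteq> NcF}"

type_synonym ('d, 'a, 'o, 'f) tree = "'d list \<Rightarrow> 'a set \<times> ('f \<Rightarrow> 'o)"

definition Sigma_alphabet :: "'o spatial_algebra \<Rightarrow> 'a set \<Rightarrow> 'f set \<Rightarrow> ('a set \<times> ('f \<Rightarrow> 'o)) set" where
  "Sigma_alphabet x NP NcF = Pow NP \<times> (NcF \<rightarrow>\<^sub>E objects x)"

definition trees :: "'o spatial_algebra \<Rightarrow> 'a set \<Rightarrow> 'f set \<Rightarrow> ('d, 'a, 'o, 'f) tree set" where
  "trees x NP NcF = {t. \<forall>u. t u \<in> Sigma_alphabet x NP NcF}"

definition satisfies ::
  "('d, 'a, 'o, 'f) tree \<Rightarrow> 'd list \<Rightarrow> 'a lit set \<Rightarrow> ('o, 'd, 'f) constr set \<Rightarrow> bool" where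
  "satisfies t u L X \<longleftrightarrow>
    (\<forall>A. (Pos A \<in> L \<longrightarrow> A \<in> fst (t u)) \<and> (Neg A \<in> L \<longrightarrow> A \<notin> fst (t u))) \<and>
    (\<forall>(P, us) \<in> X. map (\<lambda>(w, g). snd (t (u @ w)) g) us \<in> \<Union>P)"


section \<open>The CSP of a run\<close>

text \<open>A run enters only through its set \<open>D\<close> of nodes and its constraint labels \<open>X\<close>.\<close>

definition csp ::
  "'d list set \<Rightarrow> ('d list \<Rightarrow> ('o, 'd, 'f) constr set) \<Rightarrow> ('o, 'd, 'f) constr set" where
  "csp D X = {(P, map (\<lambda>(w, g). (v @ w, g)) us) | v P us. v \<in> D \<and> (P, us) \<in> X v}"

definition csp_consistent :: "'o spatial_algebra \<Rightarrow> ('o, 'd, 'f) constr set \<Rightarrow> bool" where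
  "csp_consistent x C \<longleftrightarrow>
    (\<exists>\<alpha>. (\<forall>(P, vs) \<in> C. \<forall>v \<in> set vs. \<alpha> v \<in> objects x) \<and> (\<forall>(P, vs) \<in> C. map \<alpha> vs \<in> \<Union>P))"

text \<open>An infinite path from the root is given by its sequence of directions.\<close>

definition path_node :: "(nat \<Rightarrow> 'd) \<Rightarrow> nat \<Rightarrow> 'd list" where
  "path_node \<beta> n = map \<beta> [0..<n]"


section \<open>Negation-free formulas and disjunctive normal form\<close>

datatype 'g fml = Gen 'g | And "'g fml" "'g fml" | Or "'g fml" "'g fml"

text \<open>A disjunctive normal form is represented by the set of its disjuncts, and a disjunct by the
  set of generators occurring in it. The normal form is the one obtained by distributing
  conjunction over disjunction, without absorption.\<close>

primrec dnf :: "'g fml \<Rightarrow> 'g set set" where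
  "dnf (Gen g) = {{g}}"
| "dnf (And a b) = {C \<union> D | C D. C \<in> dnf a \<and> D \<in> dnf b}"
| "dnf (Or a b) = dnf a \<union> dnf b"

text \<open>The normal form of \<open>\<And>\<^bsub>i \<in> I\<^esub> e i\<close>: each disjunct selects one disjunct of every conjunct.\<close>

definition dnf_Conj :: "'i set \<Rightarrow> ('i \<Rightarrow> 'g fml) \<Rightarrow> 'g set set" where
  "dnf_Conj I e = {\<Union>i\<in>I. c i | c. \<forall>i \<in> I. c i \<in> dnf (e i)}"

lemma dnf_Conj_singleton: "dnf_Conj {i} e = dnf (e i)"
proof -
  have "D \<in> dnf_Conj {i} e" if "D \<in> dnf (e i)" for D
    unfolding dnf_Conj_def using that by (intro CollectI exI[of _ "\<lambda>_. D"]) simp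
  then show ?thesis
    by (fastforce simp: dnf_Conj_def)
qed

lemma dnf_Conj_insert:
  assumes "i \<notin> I"
  shows "dnf_Conj (insert i I) e = {C \<union> D | C D. C \<in> dnf (e i) \<and> D \<in> dnf_Conj I e}"
proof (intro equalityI subsetI)
  fix E assume "E \<in> dnf_Conj (insert i I) e"
  then obtain c where c: "\<forall>j \<in> insert i I. c j \<in> dnf (e j)" "E = (\<Union>j\<in>insert i I. c j)"
    unfolding dnf_Conj_def by blast
  then have "E = c i \<union> (\<Union>j\<in>I. c j)" "c i \<in> dnf (e i)" "(\<Union>j\<in>I. c j) \<in> dnf_Conj I e"
    unfolding dnf_Conj_def by blast+
  then show "E \<in> {C \<union> D | C D. C \<in> dnf (e i) \<and> D \<in> dnf_Conj I e}"
    by blast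
next
  fix E assume "E \<in> {C \<union> D | C D. C \<in> dnf (e i) \<and> D \<in> dnf_Conj I e}"
  then obtain C c where c: "C \<in> dnf (e i)" "\<forall>j \<in> I. c j \<in> dnf (e j)" "E = C \<union> (\<Union>j\<in>I. c j)"
    unfolding dnf_Conj_def by blast
  have eq: "(\<Union>j\<in>I. (c(i := C)) j) = (\<Union>j\<in>I. c j)"
    using assms by (intro SUP_cong) auto
  have "E = (\<Union>j\<in>insert i I. (c(i := C)) j)"
    by (simp only: c(3) UN_insert fun_upd_same eq)
  moreover have "\<forall>j \<in> insert i I. (c(i := C)) j \<in> dnf (e j)"
    using c(1,2) by simp
  ultimately show "E \<in> dnf_Conj (insert i I) e"
    unfolding dnf_Conj_def by blast
qed


section \<open>Alternating automata\<close>

datatype ('l, 'c, 'm) gen = GLit 'l | GConstr 'c | GMove 'm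

record ('d, 'a, 'o, 'f, 'q) alternating_automaton =
  alt_states :: "'q set"
  alt_initial :: 'q
  alt_accepting :: "'q set"
  alt_delta :: "'q \<Rightarrow> ('a lit, ('o, 'd, 'f) constr, 'd \<times> 'q) gen fml"

definition buchi_alternating_automaton ::
  "'o spatial_algebra \<Rightarrow> 'a set \<Rightarrow> 'f set \<Rightarrow> ('d, 'a, 'o, 'f, 'q) alternating_automaton \<Rightarrow> bool" where
  "buchi_alternating_automaton x NP NcF A \<longleftrightarrow>
    finite (alt_states A) \<and>
    alt_initial A \<in> alt_states A \<and>
    alt_accepting A \<subseteq> alt_states A \<and>
    (\<forall>q \<in> alt_states A. set_fml (alt_delta A q) \<subseteq>
      GLit ` Lit NP \<union> GConstr ` Constr x NcF \<union> GMove ` (UNIV \<times> alt_states A))"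

text \<open>The history \<open>q\<^sub>0 d\<^sub>1 q\<^sub>1 \<dots> d\<^sub>n q\<^sub>n\<close> is \<open>(q\<^sub>0, [(d\<^sub>1, q\<^sub>1), \<dots>, (d\<^sub>n, q\<^sub>n)])\<close>.\<close>

type_synonym ('d, 'q) history = "'q \<times> ('d \<times> 'q) list"

definition histories ::
  "('d, 'a, 'o, 'f, 'q) alternating_automaton \<Rightarrow> nat \<Rightarrow> ('d, 'q) history set" where
  "histories A n = {(alt_initial A, s) | s. length s = n \<and> snd ` set s \<subseteq> alt_states A}"

definition fin_histories ::
  "('d, 'a, 'o, 'f, 'q) alternating_automaton \<Rightarrow> ('d, 'q) history set" where
  "fin_histories A = (\<Union>n. histories A n)"

fun Last :: "('d, 'q) history \<Rightarrow> 'q" where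
  "Last (q0, s) = (if s = [] then q0 else snd (last s))"

fun extend :: "('d, 'q) history \<Rightarrow> 'd \<Rightarrow> 'q \<Rightarrow> ('d, 'q) history" where
  "extend (q0, s) d q = (q0, s @ [(d, q)])"

definition dist_history ::
  "('d, 'q) history \<Rightarrow> ('l, 'c, 'd \<times> 'q) gen fml \<Rightarrow> ('l, 'c, ('d, 'q) history) gen fml" where
  "dist_history h = map_fml (map_gen id id (\<lambda>(d, q). extend h d q))"

text \<open>Runs are partial trees: the nodes are the elements of the domain.\<close>

type_synonym ('d, 'a, 'o, 'f, 'q) alt_run =
  "'d list \<rightharpoonup> ('d, 'q) history set \<times> 'a lit set \<times> ('o, 'd, 'f) constr set"

definition label_Y :: "('d, 'a, 'o, 'f, 'q) alt_run \<Rightarrow> 'd list \<Rightarrow> ('d, 'q) history set" where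
  "label_Y \<sigma> u = fst (the (\<sigma> u))"

definition label_L :: "('d, 'a, 'o, 'f, 'q) alt_run \<Rightarrow> 'd list \<Rightarrow> 'a lit set" where
  "label_L \<sigma> u = fst (snd (the (\<sigma> u)))"

definition label_X :: "('d, 'a, 'o, 'f, 'q) alt_run \<Rightarrow> 'd list \<Rightarrow> ('o, 'd, 'f) constr set" where
  "label_X \<sigma> u = snd (snd (the (\<sigma> u)))"

definition successor_histories ::
  "('d, 'a, 'o, 'f, 'q) alternating_automaton \<Rightarrow> nat \<Rightarrow>
    ('l, 'c, ('d, 'q) history) gen set \<Rightarrow> 'd \<Rightarrow> ('d, 'q) history set" where
  "successor_histories A n C d =
    {extend h d q | h q. h \<in> histories A n \<and> q \<in> alt_states A \<and> GMove (extend h d q) \<in> C}"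

definition is_alt_run ::
  "'o spatial_algebra \<Rightarrow> 'a set \<Rightarrow> 'f set \<Rightarrow> ('d, 'a, 'o, 'f, 'q) alternating_automaton \<Rightarrow>
    ('d, 'a, 'o, 'f) tree \<Rightarrow> ('d, 'a, 'o, 'f, 'q) alt_run \<Rightarrow> bool" where
  "is_alt_run x NP NcF A t \<sigma> \<longleftrightarrow>
    ran \<sigma> \<subseteq> Pow (fin_histories A) \<times> consistent_lits NP \<times> Pow (Constr x NcF) \<and>
    (\<forall>u d. u @ [d] \<in> dom \<sigma> \<longrightarrow> u \<in> dom \<sigma>) \<and>
    [] \<in> dom \<sigma> \<and> label_Y \<sigma> [] = {(alt_initial A, [])} \<and>
    (\<forall>u \<in> dom \<sigma>.
      \<exists>C \<in> dnf_Conj (label_Y \<sigma> u) (\<lambda>h. dist_history h (alt_delta A (Last h))).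
        label_L \<sigma> u = {l. GLit l \<in> C} \<and>
        label_X \<sigma> u = {c. GConstr c \<in> C} \<and>
        (\<forall>d. u @ [d] \<in> dom \<sigma> \<longleftrightarrow> successor_histories A (length u) C d \<noteq> {}) \<and>
        (\<forall>d. u @ [d] \<in> dom \<sigma> \<longrightarrow> label_Y \<sigma> (u @ [d]) = successor_histories A (length u) C d) \<and>
        satisfies t u (label_L \<sigma> u) (label_X \<sigma> u))"

text \<open>The infinite history \<open>q\<^sub>0 d\<^sub>1 q\<^sub>1 d\<^sub>2 q\<^sub>2 \<dots>\<close> is given by \<open>q\<^sub>0\<close> and the sequence \<open>\<rho>\<close> with
  \<open>\<rho> n = (d\<^bsub>n+1\<^esub>, q\<^bsub>n+1\<^esub>)\<close>.\<close>

definition history_along ::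
  "('d, 'a, 'o, 'f, 'q) alternating_automaton \<Rightarrow> ('d, 'a, 'o, 'f, 'q) alt_run \<Rightarrow>
    (nat \<Rightarrow> 'd) \<Rightarrow> (nat \<Rightarrow> 'd \<times> 'q) \<Rightarrow> bool" where
  "history_along A \<sigma> \<beta> \<rho> \<longleftrightarrow>
    (\<forall>n \<ge> 1. (alt_initial A, map \<rho> [0..<n]) \<in> label_Y \<sigma> (path_node \<beta> n))"

text \<open>Whether \<open>q\<^sub>0\<close> itself is counted is immaterial for infinite occurrence.\<close>

definition history_accepting ::
  "('d, 'a, 'o, 'f, 'q) alternating_automaton \<Rightarrow> (nat \<Rightarrow> 'd \<times> 'q) \<Rightarrow> bool" where
  "history_accepting A \<rho> \<longleftrightarrow> (\<exists>q \<in> alt_accepting A. \<exists>\<^sub>\<infinity>n. snd (\<rho> n) = q)"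

definition alt_branch :: "('d, 'a, 'o, 'f, 'q) alt_run \<Rightarrow> (nat \<Rightarrow> 'd) \<Rightarrow> bool" where
  "alt_branch \<sigma> \<beta> \<longleftrightarrow> (\<forall>n. path_node \<beta> n \<in> dom \<sigma>)"

definition accepting_alt_run ::
  "'o spatial_algebra \<Rightarrow> 'a set \<Rightarrow> 'f set \<Rightarrow> ('d, 'a, 'o, 'f, 'q) alternating_automaton \<Rightarrow>
    ('d, 'a, 'o, 'f) tree \<Rightarrow> ('d, 'a, 'o, 'f, 'q) alt_run \<Rightarrow> bool" where
  "accepting_alt_run x NP NcF A t \<sigma> \<longleftrightarrow>
    is_alt_run x NP NcF A t \<sigma> \<and>
    (\<forall>\<beta>. alt_branch \<sigma> \<beta> \<longrightarrow> (\<forall>\<rho>. history_along A \<sigma> \<beta> \<rho> \<longrightarrow> history_accepting A \<rho>)) \<and>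
    csp_consistent x (csp (dom \<sigma>) (label_X \<sigma>))"

definition alt_language ::
  "'o spatial_algebra \<Rightarrow> 'a set \<Rightarrow> 'f set \<Rightarrow> ('d, 'a, 'o, 'f, 'q) alternating_automaton \<Rightarrow>
    ('d, 'a, 'o, 'f) tree set" where
  "alt_language x NP NcF A = {t \<in> trees x NP NcF. \<exists>\<sigma>. accepting_alt_run x NP NcF A t \<sigma>}"


section \<open>Nondeterministic automata\<close>

text \<open>Tuples in \<open>Q\<^sup>k\<close> are functions from directions to states.\<close>

record ('d, 'a, 'o, 'f, 's) nondet_automaton =
  nd_states :: "'s set"
  nd_initial :: 's
  nd_accepting :: "'s set"
  nd_accept_all :: 's
  nd_delta :: "'s \<Rightarrow> ('a lit set \<times> ('o, 'd, 'f) constr set \<times> ('d \<Rightarrow> 's)) set"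

definition buchi_nondet_automaton ::
  "'o spatial_algebra \<Rightarrow> 'a set \<Rightarrow> 'f set \<Rightarrow> ('d, 'a, 'o, 'f, 's) nondet_automaton \<Rightarrow> bool" where
  "buchi_nondet_automaton x NP NcF B \<longleftrightarrow>
    finite (nd_states B) \<and>
    nd_initial B \<in> nd_states B \<and>
    nd_accepting B \<subseteq> nd_states B \<and>
    nd_accept_all B \<in> nd_accepting B \<and>
    (\<forall>q \<in> nd_states B.
      nd_delta B q \<subseteq> Pow (Lit NP) \<times> Pow (Constr x NcF) \<times> (UNIV \<rightarrow> nd_states B)) \<and>
    nd_delta B (nd_accept_all B) = {({}, {}, \<lambda>_. nd_accept_all B)}"

type_synonym ('d, 'a, 'o, 'f, 's) nd_run =
  "'d list \<Rightarrow> 's \<times> 'a lit set \<times> ('o, 'd, 'f) constr set"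

definition is_nd_run ::
  "'o spatial_algebra \<Rightarrow> 'a set \<Rightarrow> 'f set \<Rightarrow> ('d, 'a, 'o, 'f, 's) nondet_automaton \<Rightarrow>
    ('d, 'a, 'o, 'f) tree \<Rightarrow> ('d, 'a, 'o, 'f, 's) nd_run \<Rightarrow> bool" where
  "is_nd_run x NP NcF B t \<sigma> \<longleftrightarrow>
    range \<sigma> \<subseteq> nd_states B \<times> consistent_lits NP \<times> Pow (Constr x NcF) \<and>
    fst (\<sigma> []) = nd_initial B \<and>
    (\<forall>u. \<exists>(L, X, qs) \<in> nd_delta B (fst (\<sigma> u)).
      snd (\<sigma> u) = (L, X) \<and> (\<forall>d. fst (\<sigma> (u @ [d])) = qs d) \<and> satisfies t u L X)"

definition nd_branch_accepting ::
  "('d, 'a, 'o, 'f, 's) nondet_automaton \<Rightarrow> ('d, 'a, 'o, 'f, 's) nd_run \<Rightarrow> (nat \<Rightarrow> 'd) \<Rightarrow> bool" where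
  "nd_branch_accepting B \<sigma> \<beta> \<longleftrightarrow>
    (\<exists>q \<in> nd_accepting B. \<exists>\<^sub>\<infinity>n. fst (\<sigma> (path_node \<beta> n)) = q)"

definition accepting_nd_run ::
  "'o spatial_algebra \<Rightarrow> 'a set \<Rightarrow> 'f set \<Rightarrow> ('d, 'a, 'o, 'f, 's) nondet_automaton \<Rightarrow>
    ('d, 'a, 'o, 'f) tree \<Rightarrow> ('d, 'a, 'o, 'f, 's) nd_run \<Rightarrow> bool" where
  "accepting_nd_run x NP NcF B t \<sigma> \<longleftrightarrow>
    is_nd_run x NP NcF B t \<sigma> \<and>
    (\<forall>\<beta>. nd_branch_accepting B \<sigma> \<beta>) \<and>
    csp_consistent x (csp UNIV (\<lambda>u. snd (snd (\<sigma> u))))"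

definition nd_language ::
  "'o spatial_algebra \<Rightarrow> 'a set \<Rightarrow> 'f set \<Rightarrow> ('d, 'a, 'o, 'f, 's) nondet_automaton \<Rightarrow>
    ('d, 'a, 'o, 'f) tree set" where
  "nd_language x NP NcF B = {t \<in> trees x NP NcF. \<exists>\<sigma>. accepting_nd_run x NP NcF B t \<sigma>}"

end

theory Submission
  imports Defs "HOL-Library.Infinite_Set"
begin

text \<open>The automaton is the breakpoint construction of Miyano and Hayashi: its states are the pairs
  \<open>(S, W)\<close> with \<open>W \<subseteq> S - F\<close>, where \<open>S\<close> collects the states reached at a node and \<open>W\<close> those that
  still owe a visit to \<open>F\<close> since \<open>W\<close> was last empty. A state is in one of two positions if it lies in
  \<open>F\<close> and in one of three otherwise, hence \<open>2\<^bsup>|F|\<^esup>3\<^bsup>|Q|-|F|\<^esup>\<close> pairs.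

  Such pairs forget histories, whereas a run of the alternating automaton may let two histories
  with the same last state proceed differently. An accepting run is made independent of histories
  as follows. Every infinite history visits \<open>F\<close> infinitely often and the tree of histories is
  finitely branching, so by Koenig's lemma histories have natural ranks that drop at every step not
  entering \<open>F\<close>. Copying, for each node and state, the choice made at a history of least rank keeps
  this property, and the maximal rank over \<open>W\<close> drops until \<open>W\<close> becomes empty.\<close>

text \<open>Each record type declares its own \<open>extend\<close>, shadowing the function on histories.\<close>

hide_const (open) nondet_automaton.extend alternating_automaton.extend spatial_algebra.extend

section \<open>Normal forms, satisfaction and constraint systems under renaming and
  inclusion\<close>

lemma dnf_map_fml: "dnf (map_fml f e) = image f ` dnf e"
proof (induction e)
  case (And a b)
  show ?case
  proof (intro equalityI subsetI)
    fix E assume "E \<in> dnf (map_fml f (And a b))"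
    then obtain C D where "C \<in> dnf a" "D \<in> dnf b" "E = f ` C \<union> f ` D"
      using And by auto
    then have "C \<union> D \<in> dnf (And a b)" "E = f ` (C \<union> D)"
      by (auto simp: image_Un)
    then show "E \<in> image f ` dnf (And a b)"
      by blast
  next
    fix E assume "E \<in> image f ` dnf (And a b)"
    then obtain C D where "C \<in> dnf a" "D \<in> dnf b" "E = f ` (C \<union> D)"
      by auto
    then show "E \<in> dnf (map_fml f (And a b))"
      using And by (auto simp: image_Un)
  qed
qed (simp_all add: image_Un)

text \<open>Since \<open>dist_history\<close> only renames generators, a disjunct at a node of a run
  splits into a choice, for each history, of a disjunct of the original transition formula. In this
  form the choices of different histories become comparable.\<close>

lemma dnf_Conj_map_fml:
  "dnf_Conj I (\<lambda>i. map_fml (f i) (e i)) =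
    {\<Union>i\<in>I. f i ` D i | D. \<forall>i \<in> I. D i \<in> dnf (e i)}"
proof (intro equalityI subsetI)
  fix C assume "C \<in> dnf_Conj I (\<lambda>i. map_fml (f i) (e i))"
  then obtain c where C: "C = (\<Union>i\<in>I. c i)" and c: "\<forall>i \<in> I. \<exists>D. D \<in> dnf (e i) \<and> c i = f i ` D"
    unfolding dnf_Conj_def dnf_map_fml by (auto simp: image_iff Bex_def)
  from bchoice[OF c] obtain D where "\<forall>i \<in> I. D i \<in> dnf (e i) \<and> c i = f i ` D i"
    by blast
  with C show "C \<in> {\<Union>i\<in>I. f i ` D i | D. \<forall>i \<in> I. D i \<in> dnf (e i)}"
    by (intro CollectI exI[of _ D]) simp
next
  fix C assume "C \<in> {\<Union>i\<in>I. f i ` D i | D. \<forall>i \<in> I. D i \<in> dnf (e i)}"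
  then obtain D where "C = (\<Union>i\<in>I. f i ` D i)" "\<forall>i \<in> I. D i \<in> dnf (e i)"
    by blast
  then show "C \<in> dnf_Conj I (\<lambda>i. map_fml (f i) (e i))"
    unfolding dnf_Conj_def dnf_map_fml by (intro CollectI exI[of _ "\<lambda>i. f i ` D i"]) simp
qed

lemma dnf_subset_set_fml: "C \<in> dnf e \<Longrightarrow> C \<subseteq> set_fml e"
  by (induction e arbitrary: C) fastforce+

text \<open>Inclusion is demanded only where constraints occur, because strategies are defined at
  all nodes and alternating runs only on their domain.\<close>

lemma csp_mono:
  assumes "\<And>u. u \<in> D \<Longrightarrow> X u \<noteq> {} \<Longrightarrow> u \<in> E \<and> X u \<subseteq> Y u"
  shows "csp D X \<subseteq> csp E Y"
  using assms unfolding csp_def by blast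

lemma csp_consistent_subset:
  "csp_consistent x D \<Longrightarrow> C \<subseteq> D \<Longrightarrow> csp_consistent x C"
  unfolding csp_consistent_def by (meson subset_eq)

lemma satisfies_mono:
  "satisfies t u L X \<Longrightarrow> L' \<subseteq> L \<Longrightarrow> X' \<subseteq> X \<Longrightarrow> satisfies t u L' X'"
  unfolding satisfies_def by blast

text \<open>The set of concepts true at a node cannot both contain and omit \<open>A\<close>.
  Consistency of the labels of a run thus follows from satisfaction.\<close>

lemma satisfies_consistent_lits:
  "satisfies t u L X \<Longrightarrow> L \<subseteq> Lit NP \<Longrightarrow> L \<in> consistent_lits NP"
  unfolding satisfies_def consistent_lits_def by blast

section \<open>Koenig's lemma in the form of natural ranks\<close>

text \<open>An infinite chain of steps outside \<open>G\<close> would yield an infinite path of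
  \<open>T\<close> that avoids \<open>G\<close> from some point on, so the step relation
  \<open>R\<close> is well-founded. Well-founded induction and finite branching make the set
  \<open>below s\<close> of descendants finite. Its cardinality is the rank, and it drops strictly
  because \<open>R\<close> has no cycles.\<close>

lemma finitely_branching_rank:
  fixes T :: "'x list set"
  assumes prefix: "\<And>s x. s @ [x] \<in> T \<Longrightarrow> s \<in> T"
    and fin: "\<And>s. finite {x. s @ [x] \<in> T}"
    and path: "\<And>\<rho>. (\<And>n. map \<rho> [0..<n] \<in> T) \<Longrightarrow> \<exists>\<^sub>\<infinity>n. \<rho> n \<in> G"
  obtains r :: "'x list \<Rightarrow> nat" where
    "\<And>s x. s @ [x] \<in> T \<Longrightarrow> x \<notin> G \<Longrightarrow> r (s @ [x]) < r s"
proof -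
  define R where "R = {(s @ [x], s) | s x. s @ [x] \<in> T \<and> x \<notin> G}"
  have take_T: "take n s \<in> T" if "s \<in> T" for n s
    using that
  proof (induction s rule: rev_induct)
    case (snoc x s)
    then show ?case
      using prefix[of s x] by (cases "n \<le> length s") auto
  qed simp
  have "wf R"
    unfolding wf_iff_no_infinite_down_chain
  proof
    assume "\<exists>f. \<forall>i. (f (Suc i), f i) \<in> R"
    then obtain f where "\<forall>i. \<exists>x. f (Suc i) = f i @ [x] \<and> f i @ [x] \<in> T \<and> x \<notin> G"
      unfolding R_def by auto
    then obtain y where f: "\<And>i. f (Suc i) = f i @ [y i]" "\<And>i. f i @ [y i] \<in> T" "\<And>i. y i \<notin> G"
      by metis
    have len: "length (f i) = length (f 0) + i" for i
      by (induction i) (simp_all add: f(1))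
    have nth: "f j ! k = f i ! k" if "i \<le> j" "k < length (f i)" for i j k
      using that(1)
    proof (induction j rule: dec_induct)
      case (step n)
      then show ?case
        using that(2) len[of i] len[of n] by (simp add: f(1) nth_append)
    qed simp
    \<comment> \<open>The limit of the chain: \<open>f (Suc n)\<close> is the first list certain to
      be longer than \<open>n\<close>, and later lists keep that entry. Entries before
      \<open>length (f 0)\<close> belong to the start of the chain and may lie in
      \<open>G\<close>.\<close>
    define \<rho> where "\<rho> n = f (Suc n) ! n" for n
    have "map \<rho> [0..<n] = take n (f n)" for n
    proof (rule nth_equalityI)
      fix k assume "k < length (map \<rho> [0..<n])"
      then show "map \<rho> [0..<n] ! k = take n (f n) ! k"
        using nth[of "Suc k" n k] len[of "Suc k"] by (simp add: \<rho>_def)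
    qed (simp add: len[of n])
    then have "\<exists>\<^sub>\<infinity>n. \<rho> n \<in> G"
      using f(2) prefix take_T by (intro path) metis
    then obtain n where n: "n \<ge> length (f 0)" "\<rho> n \<in> G"
      unfolding INFM_nat_le by blast
    \<comment> \<open>Position \<open>n\<close> is filled by the step from \<open>f i\<close> to
      \<open>f (Suc i)\<close>, since \<open>f i\<close> has length \<open>n\<close>.\<close>
    define i where "i = n - length (f 0)"
    have "\<rho> n = f (Suc i) ! n"
      using n(1) nth[of "Suc i" "Suc n" n] len[of "Suc i"] by (simp add: \<rho>_def i_def)
    also have "\<dots> = y i"
      using n(1) len[of i] by (simp add: f(1) i_def nth_append)
    finally show False
      using n(2) f(3) by simp
  qed
  define below where "below s = {s'. (s', s) \<in> R\<^sup>*}" for s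
  have "finite (below s)" for s
    using \<open>wf R\<close>
  proof (induction s rule: wf_induct_rule)
    case (less s)
    have "below s \<subseteq> insert s (\<Union>x \<in> {x. (s @ [x], s) \<in> R}. below (s @ [x]))"
    proof
      fix s' assume "s' \<in> below s"
      then have "(s', s) \<in> R\<^sup>*"
        by (simp add: below_def)
      then show "s' \<in> insert s (\<Union>x \<in> {x. (s @ [x], s) \<in> R}. below (s @ [x]))"
        by (cases rule: rtranclE) (auto simp: below_def R_def)
    qed
    moreover have "finite {x. (s @ [x], s) \<in> R}"
      using fin[of s] by (rule rev_finite_subset) (auto simp: R_def)
    ultimately show ?case
      using less by (auto intro: finite_subset)
  qed
  moreover have "below (s @ [x]) \<subset> below s" if "s @ [x] \<in> T" "x \<notin> G" for s x
  proof -
    have R: "(s @ [x], s) \<in> R"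
      using that by (auto simp: R_def)
    then have "s \<notin> below (s @ [x])"
      using \<open>wf R\<close> unfolding below_def
      by (metis mem_Collect_eq rtrancl_into_trancl1 rtrancl_into_trancl2 wf_acyclic acyclic_def)
    moreover have "s \<in> below s" "below (s @ [x]) \<subseteq> below s"
      using R by (auto simp: below_def intro: rtrancl_into_rtrancl)
    ultimately show ?thesis
      by blast
  qed
  ultimately show ?thesis
    by (intro that[of "\<lambda>s. card (below s)"] psubset_card_mono) auto
qed

section \<open>Counting breakpoint pairs\<close>

lemma card_breakpoint_pairs:
  assumes "finite Q" "F \<subseteq> Q"
  shows "finite {(S, W). S \<subseteq> Q \<and> W \<subseteq> S - F}"
    and "card {(S, W). S \<subseteq> Q \<and> W \<subseteq> S - F} \<le> 2 ^ card F * 3 ^ card (Q - F)"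
proof -
  \<comment> \<open>A function in \<open>M\<close> codes a pair: 0 outside \<open>S\<close>, 1 in
    \<open>S - W\<close>, 2 in \<open>W\<close>. As \<open>W\<close> avoids \<open>F\<close>, states
    of \<open>F\<close> take only the first two values. For an upper bound it suffices that
    \<open>?f\<close> covers all pairs.\<close>
  define M where "M = (\<Pi>\<^sub>E q \<in> Q. if q \<in> F then {0, 1} else {0, 1, 2 :: nat})"
  let ?f = "\<lambda>m. ({q \<in> Q. m q \<noteq> 0}, {q \<in> Q. m q = 2})"
  have sub: "{(S, W). S \<subseteq> Q \<and> W \<subseteq> S - F} \<subseteq> ?f ` M"
  proof clarify
    fix S W assume SO: "S \<subseteq> Q" "W \<subseteq> S - F"
    define m where
      "m = (\<lambda>q \<in> Q. if q \<in> W then 2 else if q \<in> S then 1 else 0 :: nat)"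
    have "m \<in> M" "(S, W) = ?f m"
      using SO by (auto simp: M_def m_def)
    then show "(S, W) \<in> ?f ` M"
      by blast
  qed
  have M: "finite M"
    using assms(1) by (auto simp: M_def intro!: finite_PiE)
  with sub show "finite {(S, W). S \<subseteq> Q \<and> W \<subseteq> S - F}"
    by (meson finite_imageI finite_subset)
  have "card {(S, W). S \<subseteq> Q \<and> W \<subseteq> S - F} \<le> card M"
    using surj_card_le[OF M sub] .
  also have "\<dots> = (\<Prod>q\<in>Q. if q \<in> F then 2 else 3)"
    using assms(1) by (auto simp: M_def card_PiE intro!: prod.cong)
  also have "\<dots> = 2 ^ card (Q \<inter> F) * 3 ^ card (Q \<inter> - F)"
    using assms(1) by (simp add: prod.If_cases Int_def)
  also have "\<dots> = 2 ^ card F * 3 ^ card (Q - F)"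
    using assms(2) by (simp add: Int_absorb1 Diff_eq)
  finally show "card {(S, W). S \<subseteq> Q \<and> W \<subseteq> S - F} \<le> 2 ^ card F * 3 ^ card (Q - F)" .
qed

section \<open>Breakpoint pairs along a tree\<close>

text \<open>Here and below, \<open>c q\<close> stands for the disjunct of the transition formula of
  \<open>q\<close> that is chosen at the node under consideration.\<close>

definition moves :: "('q \<Rightarrow> ('l, 'c, 'd \<times> 'q) gen set) \<Rightarrow> 'd \<Rightarrow> 'q set \<Rightarrow> 'q set" where
  "moves c d S = {q'. \<exists>q \<in> S. GMove (d, q') \<in> c q}"

definition lits :: "('q \<Rightarrow> ('l, 'c, 'm) gen set) \<Rightarrow> 'q set \<Rightarrow> 'l set" where
  "lits c S = {l. \<exists>q \<in> S. GLit l \<in> c q}"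

definition constrs :: "('q \<Rightarrow> ('l, 'c, 'm) gen set) \<Rightarrow> 'q set \<Rightarrow> 'c set" where
  "constrs c S = {k. \<exists>q \<in> S. GConstr k \<in> c q}"

text \<open>When \<open>W\<close> is empty, a new round starts one level below: it is the successors
  of all of \<open>S\<close> that owe a visit, except those already in \<open>F\<close>.\<close>

definition breakpoint_step ::
  "'q set \<Rightarrow> ('q \<Rightarrow> ('l, 'c, 'd \<times> 'q) gen set) \<Rightarrow> 'd \<Rightarrow> 'q set \<times> 'q set \<Rightarrow> 'q set \<times> 'q set" where
  "breakpoint_step F c d = (\<lambda>(S, W).
    (moves c d S, moves c d (if W = {} then S else W) - F))"

definition breakpoint_init :: "'q set \<Rightarrow> 'q \<Rightarrow> 'q set \<times> 'q set" where
  "breakpoint_init F q = ({q}, {q} - F)"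

text \<open>Nodes grow at the end of the list while recursion peels off its front, so the recursion
  runs over the reversed node.\<close>

fun breakpoint_rev ::
  "'q set \<Rightarrow> 'q \<Rightarrow> ('d list \<Rightarrow> 'q \<Rightarrow> ('l, 'c, 'd \<times> 'q) gen set) \<Rightarrow> 'd list \<Rightarrow> 'q set \<times> 'q set" where
  "breakpoint_rev F q c [] = breakpoint_init F q"
| "breakpoint_rev F q c (d # v) = breakpoint_step F (c (rev v)) d (breakpoint_rev F q c v)"

definition breakpoint ::
  "'q set \<Rightarrow> 'q \<Rightarrow> ('d list \<Rightarrow> 'q \<Rightarrow> ('l, 'c, 'd \<times> 'q) gen set) \<Rightarrow> 'd list \<Rightarrow> 'q set \<times> 'q set" where
  "breakpoint F q c u = breakpoint_rev F q c (rev u)"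

lemma breakpoint_Nil: "breakpoint F q c [] = breakpoint_init F q"
  and breakpoint_snoc: "breakpoint F q c (u @ [d]) = breakpoint_step F (c u) d (breakpoint F q c u)"
  by (simp_all add: breakpoint_def)

lemma fst_breakpoint_step: "fst (breakpoint_step F c d p) = moves c d (fst p)"
  and snd_breakpoint_step:
    "snd (breakpoint_step F c d p) = moves c d (if snd p = {} then fst p else snd p) - F"
  by (simp_all add: breakpoint_step_def case_prod_beta)

lemma fst_breakpoint_init: "fst (breakpoint_init F q) = {q}"
  by (simp add: breakpoint_init_def)

lemma breakpoint_snd_subset: "snd (breakpoint F q c u) \<subseteq> fst (breakpoint F q c u) - F"
proof (induction u rule: rev_induct)
  case Nil
  then show ?case
    by (simp add: breakpoint_Nil breakpoint_init_def)
next
  case (snoc d u)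
  then show ?case
    by (auto simp: breakpoint_snoc fst_breakpoint_step snd_breakpoint_step moves_def)
qed

section \<open>Generators under renaming, and the extension of paths and histories\<close>

lemma GMove_in_map_gen: "GMove m \<in> map_gen id id f ` E \<longleftrightarrow> (\<exists>k. m = f k \<and> GMove k \<in> E)"
proof
  assume "GMove m \<in> map_gen id id f ` E"
  then obtain g where "g \<in> E" "GMove m = map_gen id id f g"
    by blast
  then show "\<exists>k. m = f k \<and> GMove k \<in> E"
    by (cases g) auto
qed force

lemma GLit_in_map_gen: "GLit l \<in> map_gen id id f ` E \<longleftrightarrow> GLit l \<in> E"
proof
  assume "GLit l \<in> map_gen id id f ` E"
  then obtain g where "g \<in> E" "GLit l = map_gen id id f g"
    by blast
  then show "GLit l \<in> E"
    by (cases g) auto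
qed force

lemma GConstr_in_map_gen: "GConstr k \<in> map_gen id id f ` E \<longleftrightarrow> GConstr k \<in> E"
proof
  assume "GConstr k \<in> map_gen id id f ` E"
  then obtain g where "g \<in> E" "GConstr k = map_gen id id f g"
    by blast
  then show "GConstr k \<in> E"
    by (cases g) auto
qed force

lemma path_node_Suc: "path_node \<beta> (Suc n) = path_node \<beta> n @ [\<beta> n]"
  by (simp add: path_node_def)

lemma Last_extend: "Last (extend h d q) = q"
  by (cases h) simp

lemma extend_eq_iff: "extend h d q = extend h' d' q' \<longleftrightarrow> h = h' \<and> d = d' \<and> q = q'"
  by (cases h; cases h') auto

section \<open>The alternating automaton and its strategies\<close>

locale alternating =
  fixes x :: "'o spatial_algebra"
    and NP :: "'a set"
    and NcF :: "'f set"
    and A :: "('d :: finite, 'a, 'o, 'f, 'q) alternating_automaton"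
  assumes buchi: "buchi_alternating_automaton x NP NcF A"
begin

abbreviation "Q \<equiv> alt_states A"
abbreviation "F \<equiv> alt_accepting A"
abbreviation "q0 \<equiv> alt_initial A"
abbreviation "\<delta> \<equiv> alt_delta A"
abbreviation "state \<equiv> breakpoint F q0"

lemma finite_Q: "finite Q" and q0_Q: "q0 \<in> Q" and F_Q: "F \<subseteq> Q"
  using buchi by (auto simp: buchi_alternating_automaton_def)

lemma dnf_delta:
  assumes "q \<in> Q" "C \<in> dnf (\<delta> q)"
  shows "C \<subseteq> GLit ` Lit NP \<union> GConstr ` Constr x NcF \<union> GMove ` (UNIV \<times> Q)"
  using assms buchi dnf_subset_set_fml[of C "\<delta> q"] unfolding buchi_alternating_automaton_def by blast

lemma dnf_delta_GLit: "q \<in> Q \<Longrightarrow> C \<in> dnf (\<delta> q) \<Longrightarrow> GLit l \<in> C \<Longrightarrow> l \<in> Lit NP"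
  and dnf_delta_GConstr: "q \<in> Q \<Longrightarrow> C \<in> dnf (\<delta> q) \<Longrightarrow> GConstr k \<in> C \<Longrightarrow> k \<in> Constr x NcF"
  and dnf_delta_GMove: "q \<in> Q \<Longrightarrow> C \<in> dnf (\<delta> q) \<Longrightarrow> GMove (d, q') \<in> C \<Longrightarrow> q' \<in> Q"
  using dnf_delta by blast+

text \<open>A strategy chooses one disjunct of \<open>\<delta> q\<close> for each node and state, independently of the
  history that leads there.\<close>

definition strategy_accepts ::
  "('d, 'a, 'o, 'f) tree \<Rightarrow>
    ('d list \<Rightarrow> 'q \<Rightarrow> ('a lit, ('o, 'd, 'f) constr, 'd \<times> 'q) gen set) \<Rightarrow> bool" where
  "strategy_accepts t c \<longleftrightarrow>
    (\<forall>u. \<forall>q \<in> fst (state c u). c u q \<in> dnf (\<delta> q)) \<and>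
    (\<forall>u. satisfies t u (lits (c u) (fst (state c u))) (constrs (c u) (fst (state c u)))) \<and>
    (\<forall>\<beta>. \<exists>\<^sub>\<infinity>n. snd (state c (path_node \<beta> n)) = {}) \<and>
    csp_consistent x (csp UNIV (\<lambda>u. constrs (c u) (fst (state c u))))"

lemma state_subset:
  assumes "\<And>u q. q \<in> fst (state c u) \<Longrightarrow> c u q \<in> dnf (\<delta> q)"
  shows "fst (state c u) \<subseteq> Q"
proof (induction u rule: rev_induct)
  case Nil
  then show ?case
    by (simp add: breakpoint_Nil fst_breakpoint_init q0_Q)
next
  case (snoc d u)
  then show ?case
    using assms dnf_delta_GMove by (fastforce simp: breakpoint_snoc fst_breakpoint_step moves_def)
qed

section \<open>From runs of the alternating automaton to strategies\<close>

text \<open>Every state that the strategy reaches at a node is the last state of some history in the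
  label of the run there (\<open>reach\<close>). The labels of the strategy are therefore subsets of
  those of the run, and satisfaction and consistency are inherited. Only the recurrence of
  breakpoints needs the ranks.\<close>

lemma alt_run_strategy:
  assumes "accepting_alt_run x NP NcF A t \<sigma>"
  shows "\<exists>c. strategy_accepts t c"
proof -
  let ?Y = "label_Y \<sigma>" and ?L = "label_L \<sigma>" and ?X = "label_X \<sigma>"
  let ?g = "\<lambda>h. map_gen id id (\<lambda>(d, q). extend h d q)"
  have run: "is_alt_run x NP NcF A t \<sigma>"
    and acc: "\<And>\<beta> \<rho>. alt_branch \<sigma> \<beta> \<Longrightarrow> history_along A \<sigma> \<beta> \<rho> \<Longrightarrow> history_accepting A \<rho>"
    and csp: "csp_consistent x (csp (dom \<sigma>) ?X)"
    using assms by (auto simp: accepting_alt_run_def)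
  have dom_Nil: "[] \<in> dom \<sigma>" and Y_Nil: "?Y [] = {(q0, [])}"
    and "\<forall>u d. u @ [d] \<in> dom \<sigma> \<longrightarrow> u \<in> dom \<sigma>"
    using run unfolding is_alt_run_def by - (elim conjE, assumption)+
  then have dom_prefix: "\<And>u d. u @ [d] \<in> dom \<sigma> \<Longrightarrow> u \<in> dom \<sigma>"
    by blast
  define step where "step u C \<longleftrightarrow>
      ?L u = {l. GLit l \<in> C} \<and> ?X u = {k. GConstr k \<in> C} \<and>
      (\<forall>d. u @ [d] \<in> dom \<sigma> \<longleftrightarrow> successor_histories A (length u) C d \<noteq> {}) \<and>
      (\<forall>d. u @ [d] \<in> dom \<sigma> \<longrightarrow> ?Y (u @ [d]) = successor_histories A (length u) C d) \<and>
      satisfies t u (?L u) (?X u)" for u C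
  have "\<forall>u \<in> dom \<sigma>. \<exists>C \<in> dnf_Conj (?Y u) (\<lambda>h. dist_history h (\<delta> (Last h))). step u C"
    using run unfolding is_alt_run_def step_def by (elim conjE)
  \<comment> \<open>The disjunct taken at \<open>u\<close> is split by histories; those with the
    same last state may receive different disjuncts of the same formula.\<close>
  then have "\<forall>u \<in> dom \<sigma>. \<exists>D. (\<forall>h \<in> ?Y u. D h \<in> dnf (\<delta> (Last h))) \<and> step u (\<Union>h\<in>?Y u. ?g h ` D h)"
    unfolding dist_history_def dnf_Conj_map_fml by blast
  from bchoice[OF this] obtain D where
    D: "\<And>u h. u \<in> dom \<sigma> \<Longrightarrow> h \<in> ?Y u \<Longrightarrow> D u h \<in> dnf (\<delta> (Last h))"
    and step: "\<And>u. u \<in> dom \<sigma> \<Longrightarrow> step u (\<Union>h\<in>?Y u. ?g h ` D u h)"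
    by blast
  have L: "?L u = {l. GLit l \<in> (\<Union>h\<in>?Y u. ?g h ` D u h)}"
    and X: "?X u = {k. GConstr k \<in> (\<Union>h\<in>?Y u. ?g h ` D u h)}"
    and dom_snoc: "u @ [d] \<in> dom \<sigma> \<longleftrightarrow>
        successor_histories A (length u) (\<Union>h\<in>?Y u. ?g h ` D u h) d \<noteq> {}"
    and sat: "satisfies t u (?L u) (?X u)" if "u \<in> dom \<sigma>" for u d
    using step[OF that] unfolding step_def by blast+
  have Y_snoc: "?Y (u @ [d]) = successor_histories A (length u) (\<Union>h\<in>?Y u. ?g h ` D u h) d"
    if "u @ [d] \<in> dom \<sigma>" for u d
    using step[OF dom_prefix[OF that]] that unfolding step_def by blast
  have Y_sub: "u \<in> dom \<sigma> \<Longrightarrow> ?Y u \<subseteq> {(q0, s) | s. map fst s = u \<and> snd ` set s \<subseteq> Q}" for u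
  proof (induction u rule: rev_induct)
    case Nil
    then show ?case
      by (simp add: Y_Nil)
  next
    case (snoc d u)
    note u = dom_prefix[OF snoc.prems]
    show ?case
    proof
      fix h assume "h \<in> ?Y (u @ [d])"
      then obtain h' q where h': "h = extend h' d q" "q \<in> Q" "h' \<in> ?Y u"
        by (auto simp: Y_snoc[OF snoc.prems] successor_histories_def GMove_in_map_gen extend_eq_iff)
      moreover obtain s where "h' = (q0, s)" "map fst s = u" "snd ` set s \<subseteq> Q"
        using snoc.IH[OF u] h'(3) by blast
      ultimately show "h \<in> {(q0, s) | s. map fst s = u @ [d] \<and> snd ` set s \<subseteq> Q}"
        by auto
    qed
  qed
  have Last_Q: "Last h \<in> Q" if "u \<in> dom \<sigma>" "h \<in> ?Y u" for u h
  proof -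
    have "h \<in> {(q0, s) | s. map fst s = u \<and> snd ` set s \<subseteq> Q}"
      using Y_sub that by blast
    then obtain s where "h = (q0, s)" "snd ` set s \<subseteq> Q"
      by blast
    then show ?thesis
      using q0_Q by (cases s rule: rev_cases) auto
  qed
  have extend_Y: "u @ [d] \<in> dom \<sigma> \<and> extend h d q \<in> ?Y (u @ [d])"
    if "u \<in> dom \<sigma>" "h \<in> ?Y u" "GMove (d, q) \<in> D u h" for u h d q
  proof -
    have "h \<in> histories A (length u)"
      using Y_sub that(1,2) by (fastforce simp: histories_def)
    moreover have "q \<in> Q"
      using dnf_delta_GMove[OF Last_Q D] that by blast
    moreover have "GMove (extend h d q) \<in> (\<Union>h\<in>?Y u. ?g h ` D u h)"
      using that(2,3) unfolding UN_iff GMove_in_map_gen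
      by (intro bexI[of _ h] exI[of _ "(d, q)"]) simp_all
    ultimately have "extend h d q \<in>
        successor_histories A (length u) (\<Union>h\<in>?Y u. ?g h ` D u h) d"
      unfolding successor_histories_def by blast
    then show ?thesis
      using dom_snoc[OF that(1), of d] Y_snoc[of u d] by blast
  qed

  \<comment> \<open>The tree of all histories of the run, with the common initial state dropped. The
    directions in \<open>s\<close> spell the node that carries it, so an infinite path of
    \<open>T\<close> gives both a branch and a history along it.\<close>
  define T where "T = {s. map fst s \<in> dom \<sigma> \<and> (q0, s) \<in> ?Y (map fst s)}"
  obtain r :: "('d \<times> 'q) list \<Rightarrow> nat" where
    r: "\<And>s m. s @ [m] \<in> T \<Longrightarrow> m \<notin> UNIV \<times> F \<Longrightarrow> r (s @ [m]) < r s"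
  proof (rule finitely_branching_rank[of T "UNIV \<times> F"])
    fix s m assume "s @ [m] \<in> T"
    then have dom: "map fst s @ [fst m] \<in> dom \<sigma>"
      and "(q0, s @ [m]) \<in> ?Y (map fst s @ [fst m])"
      by (auto simp: T_def)
    then have "extend (q0, s) (fst m) (snd m) \<in>
        successor_histories A (length s) (\<Union>h\<in>?Y (map fst s). ?g h ` D (map fst s) h) (fst m)"
      using Y_snoc[OF dom] by simp
    then have "(q0, s) \<in> ?Y (map fst s)"
      unfolding successor_histories_def by (auto simp: GMove_in_map_gen extend_eq_iff)
    then show "s \<in> T"
      using dom_prefix[OF dom] by (simp add: T_def)
  next
    fix s
    have "m \<in> UNIV \<times> Q" if "s @ [m] \<in> T" for m
      using that Y_sub[of "map fst (s @ [m])"] by (auto simp: T_def mem_Times_iff)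
    then show "finite {m. s @ [m] \<in> T}"
      using finite_Q by (auto intro: finite_subset[of _ "UNIV \<times> Q"])
  next
    fix \<rho> :: "nat \<Rightarrow> 'd \<times> 'q"
    assume \<rho>: "\<And>n. map \<rho> [0..<n] \<in> T"
    have "path_node (fst \<circ> \<rho>) n = map fst (map \<rho> [0..<n])" for n
      by (simp add: path_node_def)
    then have "alt_branch \<sigma> (fst \<circ> \<rho>)" "history_along A \<sigma> (fst \<circ> \<rho>) \<rho>"
      using \<rho> unfolding alt_branch_def history_along_def T_def by simp_all
    then have "history_accepting A \<rho>"
      by (rule acc)
    then show "\<exists>\<^sub>\<infinity>n. \<rho> n \<in> UNIV \<times> F"
      unfolding history_accepting_def by (auto simp: mem_Times_iff elim!: frequently_elim1)
  qed blast

  define H where "H u q = {s \<in> T. map fst s = u \<and> Last (q0, s) = q}" for u q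
  define best where "best u q = arg_min r (\<lambda>s. s \<in> H u q)" for u q
  define c where "c u q = D u (q0, best u q)" for u q
  have best: "best u q \<in> H u q" "\<And>s. s \<in> H u q \<Longrightarrow> r (best u q) \<le> r s" if "H u q \<noteq> {}" for u q
  proof -
    from that obtain s where "s \<in> H u q"
      by blast
    then show "best u q \<in> H u q"
      unfolding best_def by (rule arg_min_natI)
    show "r (best u q) \<le> r s" if "s \<in> H u q" for s
      using that unfolding best_def by (rule arg_min_nat_le)
  qed
  have best_Y: "u \<in> dom \<sigma> \<and> (q0, best u q) \<in> ?Y u \<and> Last (q0, best u q) = q"
    if "H u q \<noteq> {}" for u q
    using best(1)[OF that] by (auto simp: H_def T_def)
  have best_step: "best u q @ [(d, q')] \<in> H (u @ [d]) q'"
    if "H u q \<noteq> {}" "GMove (d, q') \<in> c u q" for u q d q'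
    using extend_Y[of u "(q0, best u q)" d q'] best_Y[OF that(1)] best(1)[OF that(1)] that(2)
    by (auto simp: H_def T_def c_def)
  have reach: "q \<in> fst (state c u) \<Longrightarrow> H u q \<noteq> {}" for u q
  proof (induction u arbitrary: q rule: rev_induct)
    case Nil
    then have "[] \<in> H [] q"
      using dom_Nil Y_Nil by (simp add: H_def T_def breakpoint_Nil fst_breakpoint_init)
    then show ?case
      by blast
  next
    case (snoc d u)
    then obtain q' where "q' \<in> fst (state c u)" "GMove (d, q) \<in> c u q'"
      by (auto simp: breakpoint_snoc fst_breakpoint_step moves_def)
    then show ?case
      using best_step[OF snoc.IH] by blast
  qed
  have dnf: "c u q \<in> dnf (\<delta> q)" if "q \<in> fst (state c u)" for u q
    using best_Y[OF reach[OF that]] D[of u "(q0, best u q)"] by (auto simp: c_def)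
  have sub: "u \<in> dom \<sigma> \<and> lits (c u) (fst (state c u)) \<subseteq> ?L u \<and>
      constrs (c u) (fst (state c u)) \<subseteq> ?X u" if "fst (state c u) \<noteq> {}" for u
  proof (intro conjI)
    show "u \<in> dom \<sigma>"
      using that best_Y reach by blast
    then show "lits (c u) (fst (state c u)) \<subseteq> ?L u" "constrs (c u) (fst (state c u)) \<subseteq> ?X u"
      using best_Y[OF reach, of _ u]
      unfolding lits_def constrs_def c_def by (fastforce simp: L X GLit_in_map_gen GConstr_in_map_gen)+
  qed
  have "\<exists>\<^sub>\<infinity>n. snd (state c (path_node \<beta> n)) = {}" for \<beta>
  proof (rule ccontr)
    assume "\<not> (\<exists>\<^sub>\<infinity>n. snd (state c (path_node \<beta> n)) = {})"
    then obtain N where N: "\<And>n. n \<ge> N \<Longrightarrow> snd (state c (path_node \<beta> n)) \<noteq> {}"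
      unfolding INFM_nat_le by blast
    define rk where "rk n q = r (best (path_node \<beta> n) q)" for n q
    define W where "W n = snd (state c (path_node \<beta> n))" for n
    have finW: "finite (W n)" for n
      unfolding W_def
      using breakpoint_snd_subset[of F q0 c] state_subset[of c, OF dnf] finite_Q
      by (meson Diff_subset finite_subset order_trans)
    \<comment> \<open>From level \<open>N\<close> on there is no reset, so each owing state stems
      from an owing state one level above by a move that avoids \<open>F\<close>. This move extends
      the best history of its source and lowers the rank, and the best history at the target ranks
      no higher. The second conjunct carries the contradiction, since subtraction truncates at
      0.\<close>
    have decr: "rk n q \<le> Max (rk N ` W N) - (n - N) \<and> n - N \<le> Max (rk N ` W N)"
      if "n \<ge> N" "q \<in> W n" for n q
      using that
    proof (induction n arbitrary: q rule: dec_induct)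
      case base
      then show ?case
        using finW by simp
    next
      case (step n)
      have "W (Suc n) = moves (c (path_node \<beta> n)) (\<beta> n) (W n) - F"
        using N[OF step.hyps(1)]
        by (simp add: W_def path_node_Suc breakpoint_snoc snd_breakpoint_step)
      then obtain p where p: "p \<in> W n" "GMove (\<beta> n, q) \<in> c (path_node \<beta> n) p" "q \<notin> F"
        using step.prems by (auto simp: moves_def)
      then have "p \<in> fst (state c (path_node \<beta> n))"
        using breakpoint_snd_subset[of F q0 c "path_node \<beta> n"] by (auto simp: W_def)
      then have "best (path_node \<beta> n) p @ [(\<beta> n, q)] \<in> H (path_node \<beta> (Suc n)) q"
        unfolding path_node_Suc using p(2) by (intro best_step reach)
      then have "rk (Suc n) q < rk n p"
        using r[of "best (path_node \<beta> n) p" "(\<beta> n, q)"] best(2) p(3)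
        unfolding rk_def H_def by fastforce
      with step.IH[OF p(1)] step.hyps show ?case
        by linarith
    qed
    obtain q where "q \<in> W (Suc (N + Max (rk N ` W N)))"
      using N unfolding W_def by (metis add_Suc_right ex_in_conv le_add1)
    from decr[OF _ this] show False
      by simp
  qed
  moreover have "satisfies t u (lits (c u) (fst (state c u))) (constrs (c u) (fst (state c u)))" for u
  proof (cases "fst (state c u) = {}")
    case True
    then show ?thesis
      by (simp add: lits_def constrs_def satisfies_def)
  next
    case False
    with sub sat show ?thesis
      by (meson satisfies_mono)
  qed
  moreover have "csp_consistent x (csp UNIV (\<lambda>u. constrs (c u) (fst (state c u))))"
    using csp
  proof (rule csp_consistent_subset)
    show "csp UNIV (\<lambda>u. constrs (c u) (fst (state c u))) \<subseteq> csp (dom \<sigma>) ?X"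
    proof (rule csp_mono)
      fix u assume "constrs (c u) (fst (state c u)) \<noteq> {}"
      then have "fst (state c u) \<noteq> {}"
        by (auto simp: constrs_def)
      then show "u \<in> dom \<sigma> \<and> constrs (c u) (fst (state c u)) \<subseteq> ?X u"
        using sub by blast
    qed
  qed
  ultimately show ?thesis
    using dnf unfolding strategy_accepts_def by blast
qed

section \<open>From strategies to runs of the alternating automaton\<close>

text \<open>The run carries exactly the histories that follow the strategy. One that avoided
  \<open>F\<close> from some level on would, after the next breakpoint, keep its last state in
  \<open>W\<close> forever, although breakpoints recur on every branch.\<close>

lemma strategy_alt_run:
  assumes "strategy_accepts t c"
  shows "\<exists>\<sigma>. accepting_alt_run x NP NcF A t \<sigma>"
proof -
  let ?g = "\<lambda>h. map_gen id id (\<lambda>(d, q). extend h d q)"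
  let ?S = "\<lambda>u. fst (state c u)"
  have dnf: "\<And>u q. q \<in> ?S u \<Longrightarrow> c u q \<in> dnf (\<delta> q)"
    and sat: "\<And>u. satisfies t u (lits (c u) (?S u)) (constrs (c u) (?S u))"
    and branch: "\<And>\<beta>. \<exists>\<^sub>\<infinity>n. snd (state c (path_node \<beta> n)) = {}"
    and csp: "csp_consistent x (csp UNIV (\<lambda>u. constrs (c u) (?S u)))"
    using assms by (auto simp: strategy_accepts_def)
  have S_Q: "?S u \<subseteq> Q" for u
    using dnf by (rule state_subset)
  define Y where "Y u = {(q0, s) | s. map fst s = u \<and>
    (\<forall>i < length s. GMove (s ! i) \<in> c (take i u) (Last (q0, take i s)))}" for u
  have Y_Nil: "Y [] = {(q0, [])}"
    by (auto simp: Y_def)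
  have Y_extend: "extend h d q \<in> Y (u @ [d]) \<longleftrightarrow> h \<in> Y u \<and> GMove (d, q) \<in> c u (Last h)" for h d q u
    by (cases h) (auto simp: Y_def less_Suc_eq nth_append simp del: Last.simps)
  have Y_snoc: "\<exists>h' q. h = extend h' d q" if "h \<in> Y (u @ [d])" for h u d
  proof -
    from that obtain s where s: "h = (q0, s)" "map fst s = u @ [d]"
      by (auto simp: Y_def)
    then show ?thesis
      by (cases s rule: rev_cases) (auto intro!: exI[of _ "(q0, butlast s)"])
  qed
  have Y_state: "Last h \<in> ?S u" if "h \<in> Y u" for h u
    using that
  proof (induction u arbitrary: h rule: rev_induct)
    case Nil
    then show ?case
      by (simp add: Y_Nil breakpoint_Nil fst_breakpoint_init)
  next
    case (snoc d u)
    from Y_snoc[OF this(2)] obtain h' q where h: "h = extend h' d q"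
      by blast
    with snoc show ?case
      unfolding breakpoint_snoc fst_breakpoint_step moves_def h Y_extend Last_extend by blast
  qed
  have Y_hist: "Y u \<subseteq> histories A (length u)" for u
  proof (induction u rule: rev_induct)
    case Nil
    then show ?case
      by (simp add: Y_Nil histories_def)
  next
    case (snoc d u)
    show ?case
    proof
      fix h assume h: "h \<in> Y (u @ [d])"
      from Y_snoc[OF h] obtain h' q where h': "h = extend h' d q"
        by blast
      moreover have "h' \<in> histories A (length u)"
        using h h' snoc Y_extend by blast
      moreover have "q \<in> Q"
        using Y_state[OF h] S_Q h' by (auto simp: Last_extend)
      ultimately show "h \<in> histories A (length (u @ [d]))"
        by (auto simp: histories_def)
    qed
  qed
  define C where "C u = (\<Union>h\<in>Y u. ?g h ` c u (Last h))" for u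
  \<comment> \<open>The domain is forced: a successor must exist exactly when its set of histories
    is nonempty.\<close>
  define \<sigma> where "\<sigma> u = (if Y u = {} then None
    else Some (Y u, {l. GLit l \<in> C u}, {k. GConstr k \<in> C u}))" for u
  have dom: "dom \<sigma> = {u. Y u \<noteq> {}}"
    by (auto simp: \<sigma>_def split: if_splits)
  have label: "label_Y \<sigma> u = Y u" "label_L \<sigma> u = {l. GLit l \<in> C u}"
    "label_X \<sigma> u = {k. GConstr k \<in> C u}" if "Y u \<noteq> {}" for u
    using that by (simp_all add: \<sigma>_def label_Y_def label_L_def label_X_def)
  have C_lits: "{l. GLit l \<in> C u} \<subseteq> lits (c u) (?S u)" for u
    using Y_state by (auto simp: C_def GLit_in_map_gen lits_def)
  have C_constrs: "{k. GConstr k \<in> C u} \<subseteq> constrs (c u) (?S u)" for u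
    using Y_state by (auto simp: C_def GConstr_in_map_gen constrs_def)
  have C_sat: "satisfies t u {l. GLit l \<in> C u} {k. GConstr k \<in> C u}" for u
    using sat C_lits C_constrs by (rule satisfies_mono)
  have lits: "lits (c u) (?S u) \<subseteq> Lit NP" for u
    using dnf dnf_delta_GLit S_Q by (fastforce simp: lits_def)
  have constrs: "constrs (c u) (?S u) \<subseteq> Constr x NcF" for u
    using dnf dnf_delta_GConstr S_Q unfolding constrs_def by blast
  have C_dnf: "C u \<in> dnf_Conj (Y u) (\<lambda>h. dist_history h (\<delta> (Last h)))" for u
    unfolding dnf_Conj_def C_def using dnf Y_state
    by (intro CollectI exI[of _ "\<lambda>h. ?g h ` c u (Last h)"]) (auto simp: dist_history_def dnf_map_fml)
  have succ: "successor_histories A (length u) (C u) d = Y (u @ [d])" for u d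
  proof (intro equalityI subsetI)
    fix h assume "h \<in> successor_histories A (length u) (C u) d"
    then show "h \<in> Y (u @ [d])"
      by (auto simp: successor_histories_def C_def GMove_in_map_gen extend_eq_iff Y_extend
          simp del: extend.simps Last.simps)
  next
    fix h assume h: "h \<in> Y (u @ [d])"
    from Y_snoc[OF h] obtain h' q where h': "h = extend h' d q"
      by blast
    moreover have "h' \<in> Y u" "GMove (d, q) \<in> c u (Last h')"
      using h h' by (auto simp: Y_extend)
    moreover have "q \<in> Q"
      using Y_state[OF h] S_Q h' by (auto simp: Last_extend)
    moreover have "GMove h \<in> C u"
      using calculation unfolding C_def UN_iff GMove_in_map_gen
      by (intro bexI[of _ h'] exI[of _ "(d, q)"]) simp_all
    ultimately show "h \<in> successor_histories A (length u) (C u) d"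
      using Y_hist unfolding successor_histories_def by blast
  qed
  have "is_alt_run x NP NcF A t \<sigma>"
    unfolding is_alt_run_def
  proof (intro conjI allI impI ballI)
    show "ran \<sigma> \<subseteq> Pow (fin_histories A) \<times> consistent_lits NP \<times> Pow (Constr x NcF)"
    proof
      fix y assume "y \<in> ran \<sigma>"
      then obtain u where "y = (Y u, {l. GLit l \<in> C u}, {k. GConstr k \<in> C u})"
        by (auto simp: ran_def \<sigma>_def split: if_splits)
      moreover have "{l. GLit l \<in> C u} \<in> consistent_lits NP"
        using C_sat order_trans[OF C_lits lits] by (rule satisfies_consistent_lits)
      moreover have "{k. GConstr k \<in> C u} \<subseteq> Constr x NcF"
        using C_constrs constrs by (rule order_trans)
      moreover have "Y u \<subseteq> fin_histories A"
        using Y_hist by (auto simp: fin_histories_def)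
      ultimately show "y \<in> Pow (fin_histories A) \<times> consistent_lits NP \<times> Pow (Constr x NcF)"
        by blast
    qed
  next
    fix u d assume "u @ [d] \<in> dom \<sigma>"
    then show "u \<in> dom \<sigma>"
      using Y_snoc Y_extend unfolding dom by blast
  next
    show "[] \<in> dom \<sigma>"
      by (simp add: dom Y_Nil)
    show "label_Y \<sigma> [] = {(q0, [])}"
      by (simp add: label Y_Nil)
  next
    fix u assume "u \<in> dom \<sigma>"
    then have u: "Y u \<noteq> {}"
      by (simp add: dom)
    show "\<exists>C \<in> dnf_Conj (label_Y \<sigma> u) (\<lambda>h. dist_history h (\<delta> (Last h))).
        label_L \<sigma> u = {l. GLit l \<in> C} \<and> label_X \<sigma> u = {c. GConstr c \<in> C} \<and>
        (\<forall>d. u @ [d] \<in> dom \<sigma> \<longleftrightarrow> successor_histories A (length u) C d \<noteq> {}) \<and>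
        (\<forall>d. u @ [d] \<in> dom \<sigma> \<longrightarrow> label_Y \<sigma> (u @ [d]) = successor_histories A (length u) C d) \<and>
        satisfies t u (label_L \<sigma> u) (label_X \<sigma> u)"
      using C_dnf C_sat by (intro bexI[of _ "C u"]) (simp_all add: label u succ dom)
  qed
  moreover have "history_accepting A \<rho>" if "alt_branch \<sigma> \<beta>" "history_along A \<sigma> \<beta> \<rho>" for \<beta> \<rho>
  proof (rule ccontr)
    assume "\<not> history_accepting A \<rho>"
    \<comment> \<open>Because \<open>F\<close> is finite, visiting \<open>F\<close> infinitely often
      means visiting one of its states infinitely often. A rejected history thus leaves
      \<open>F\<close> for good.\<close>
    then have "\<not> (\<exists>\<^sub>\<infinity>n. \<exists>q \<in> F. snd (\<rho> n) = q)"
      unfolding history_accepting_def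
      by (subst frequently_bex_finite_distrib[OF finite_subset[OF F_Q finite_Q]])
    then obtain N where N: "\<And>n. n \<ge> N \<Longrightarrow> snd (\<rho> n) \<notin> F"
      unfolding INFM_nat_le by auto
    let ?h = "\<lambda>n. (q0, map \<rho> [0..<n])" and ?u = "path_node \<beta>"
    have h: "?h n \<in> Y (?u n)" for n
    proof (cases "n = 0")
      case False
      then have "?h n \<in> label_Y \<sigma> (?u n)"
        using that(2) by (simp add: history_along_def)
      moreover have "Y (?u n) \<noteq> {}"
        using that(1) by (simp add: alt_branch_def dom)
      ultimately show ?thesis
        by (simp add: label)
    qed (simp add: path_node_def Y_Nil)
    have last: "Last (?h (Suc n)) = snd (\<rho> n)" for n
      by simp
    have move: "GMove (\<beta> n, snd (\<rho> n)) \<in> c (?u n) (Last (?h n))" for n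
    proof -
      have "fst (\<rho> n) = \<beta> n"
        using h[of "Suc n"] by (auto simp: Y_def path_node_def)
      then have "?h (Suc n) = extend (?h n) (\<beta> n) (snd (\<rho> n))"
        by (simp add: prod_eq_iff)
      then show ?thesis
        using h[of "Suc n"] Y_extend[of "?h n" "\<beta> n" "snd (\<rho> n)" "?u n"] by (simp add: path_node_Suc)
    qed
    obtain m where m: "m \<ge> N" "snd (state c (?u m)) = {}"
      using branch[of \<beta>] unfolding INFM_nat_le by blast
    \<comment> \<open>The breakpoint at level \<open>m\<close> makes every successor outside
      \<open>F\<close> owe a visit, hence the start at \<open>Suc m\<close>. No later state of the
      history lies in \<open>F\<close>, so the debt is never settled.\<close>
    have "Last (?h n) \<in> snd (state c (?u n))" if "n \<ge> Suc m" for n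
      using that
    proof (induction n rule: dec_induct)
      case base
      have "snd (\<rho> m) \<in> moves (c (?u m)) (\<beta> m) (?S (?u m)) - F"
        using move[of m] Y_state[OF h[of m]] N m(1) unfolding moves_def by blast
      then show ?case
        using m(2) by (simp only: last path_node_Suc breakpoint_snoc snd_breakpoint_step if_True simp_thms)
    next
      case (step n)
      then have "snd (\<rho> n) \<in> moves (c (?u n)) (\<beta> n) (snd (state c (?u n))) - F"
        using move[of n] N[of n] m(1) unfolding moves_def by auto
      moreover have "snd (state c (?u n)) \<noteq> {}"
        using step.IH by blast
      ultimately show ?case
        by (simp only: last path_node_Suc breakpoint_snoc snd_breakpoint_step if_False)
    qed
    moreover obtain n where "n \<ge> Suc m" "snd (state c (?u n)) = {}"
      using branch[of \<beta>] unfolding INFM_nat_le by blast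
    ultimately show False
      by blast
  qed
  moreover have "csp_consistent x (csp (dom \<sigma>) (label_X \<sigma>))"
    using csp
  proof (rule csp_consistent_subset)
    show "csp (dom \<sigma>) (label_X \<sigma>) \<subseteq> csp UNIV (\<lambda>u. constrs (c u) (?S u))"
      using C_constrs by (intro csp_mono) (simp add: dom label)
  qed
  ultimately show ?thesis
    unfolding accepting_alt_run_def by blast
qed

text \<open>Strategies are the middle term between the two kinds of automata.\<close>

lemma alt_language_strategy:
  "alt_language x NP NcF A = {t \<in> trees x NP NcF. \<exists>c. strategy_accepts t c}"
  unfolding alt_language_def using alt_run_strategy strategy_alt_run by blast

section \<open>The simulating automaton\<close>

definition breakpoint_pairs :: "('q set \<times> 'q set) set" where
  "breakpoint_pairs = {(S, W). S \<subseteq> Q \<and> W \<subseteq> S - F}"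

text \<open>The pair \<open>({}, {})\<close> only steps to itself, so it doubles as the accept-all state.\<close>

definition simulation :: "('q set \<times> 'q set \<Rightarrow> nat) \<Rightarrow> ('d, 'a, 'o, 'f, nat) nondet_automaton" where
  "simulation e =
    \<lparr> nd_states = e ` breakpoint_pairs,
      nd_initial = e (breakpoint_init F q0),
      nd_accepting = e ` {p \<in> breakpoint_pairs. snd p = {}},
      nd_accept_all = e ({}, {}),
      nd_delta = (\<lambda>n. let p = inv_into breakpoint_pairs e n in
        {(lits c (fst p), constrs c (fst p), \<lambda>d. e (breakpoint_step F c d p)) | c.
          \<forall>q \<in> fst p. c q \<in> dnf (\<delta> q)}) \<rparr>"

lemma finite_breakpoint_pairs: "finite breakpoint_pairs"
  unfolding breakpoint_pairs_def using finite_Q F_Q by (rule card_breakpoint_pairs)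

lemma card_breakpoint_pairs_le:
  "real (card breakpoint_pairs) \<le> (2 / 3) ^ card F * 3 ^ card Q"
proof -
  have "card F + card (Q - F) = card Q"
    using finite_Q F_Q by (simp add: card_Diff_subset card_mono finite_subset)
  then have "(2 / 3) ^ card F * 3 ^ card Q = (2 / 3 :: real) ^ card F * 3 ^ (card F + card (Q - F))"
    by simp
  also have "\<dots> = real (2 ^ card F * 3 ^ card (Q - F))"
    by (simp add: power_add power_divide)
  finally show ?thesis
    using card_breakpoint_pairs(2)[OF finite_Q F_Q] unfolding breakpoint_pairs_def
    by (simp only: of_nat_le_iff)
qed

lemma breakpoint_init_pairs: "breakpoint_init F q0 \<in> breakpoint_pairs"
  by (auto simp: breakpoint_pairs_def breakpoint_init_def q0_Q)

lemma breakpoint_step_pairs: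
  assumes "p \<in> breakpoint_pairs" "\<forall>q \<in> fst p. c q \<in> dnf (\<delta> q)"
  shows "breakpoint_step F c d p \<in> breakpoint_pairs"
proof -
  have "fst p \<subseteq> Q" "snd p \<subseteq> fst p"
    using assms(1) by (auto simp: breakpoint_pairs_def)
  then have "moves c d (fst p) \<subseteq> Q" "moves c d (if snd p = {} then fst p else snd p) \<subseteq> moves c d (fst p)"
    using assms(2) dnf_delta_GMove unfolding moves_def by (blast, auto)
  then show ?thesis
    unfolding breakpoint_pairs_def breakpoint_step_def case_prod_beta mem_Collect_eq fst_conv snd_conv
    by blast
qed

lemma lits_subset: "S \<subseteq> Q \<Longrightarrow> \<forall>q \<in> S. c q \<in> dnf (\<delta> q) \<Longrightarrow> lits c S \<subseteq> Lit NP"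
  and constrs_subset: "S \<subseteq> Q \<Longrightarrow> \<forall>q \<in> S. c q \<in> dnf (\<delta> q) \<Longrightarrow> constrs c S \<subseteq> Constr x NcF"
  using dnf_delta_GLit dnf_delta_GConstr unfolding lits_def constrs_def by blast+

section \<open>Correctness of the simulation under an injective coding of pairs by naturals\<close>

context
  fixes e :: "'q set \<times> 'q set \<Rightarrow> nat"
  assumes inj: "inj_on e breakpoint_pairs"
begin

lemma nd_delta_simulation:
  "p \<in> breakpoint_pairs \<Longrightarrow> nd_delta (simulation e) (e p) =
    {(lits c (fst p), constrs c (fst p), \<lambda>d. e (breakpoint_step F c d p)) | c.
      \<forall>q \<in> fst p. c q \<in> dnf (\<delta> q)}"
  by (simp add: simulation_def inv_into_f_f[OF inj])

lemma buchi_simulation: "buchi_nondet_automaton x NP NcF (simulation e)"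
proof -
  have empty: "({}, {}) \<in> breakpoint_pairs"
    by (simp add: breakpoint_pairs_def)
  have "nd_delta (simulation e) (e p) \<subseteq>
      Pow (Lit NP) \<times> Pow (Constr x NcF) \<times> (UNIV \<rightarrow> nd_states (simulation e))"
    if p: "p \<in> breakpoint_pairs" for p
  proof -
    have "fst p \<subseteq> Q"
      using p by (auto simp: breakpoint_pairs_def)
    then show ?thesis
      using lits_subset[of "fst p"] constrs_subset[of "fst p"] breakpoint_step_pairs[OF p]
      unfolding nd_delta_simulation[OF p] by (fastforce simp: simulation_def)
  qed
  moreover have "nd_delta (simulation e) (e ({}, {})) = {({}, {}, \<lambda>_. e ({}, {}))}"
    by (simp add: nd_delta_simulation[OF empty] lits_def constrs_def breakpoint_step_def moves_def)
  ultimately show ?thesis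
    using empty breakpoint_init_pairs finite_breakpoint_pairs
    by (auto simp: buchi_nondet_automaton_def simulation_def)
qed

text \<open>The accepting set is finite, so infinitely many breakpoints make one accepting state
  recur; injectivity of \<open>e\<close> lets the second component be read off the code.\<close>

lemma infinitely_often_nd_accepting:
  assumes "\<And>n. p n \<in> breakpoint_pairs"
  shows "(\<exists>s \<in> nd_accepting (simulation e). \<exists>\<^sub>\<infinity>n. e (p n) = s) \<longleftrightarrow> (\<exists>\<^sub>\<infinity>n. snd (p n) = {})"
proof -
  have fin: "finite (nd_accepting (simulation e))"
    using finite_breakpoint_pairs by (simp add: simulation_def)
  have "(\<exists>s \<in> nd_accepting (simulation e). e (p n) = s) \<longleftrightarrow> snd (p n) = {}" for n
    using assms[of n] inj by (auto simp: simulation_def inj_on_def)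
  with frequently_bex_finite_distrib[OF fin, of "\<lambda>n s. e (p n) = s" cofinite]
  show ?thesis
    by simp
qed

text \<open>Each node is labelled with the code of its breakpoint pair, and \<open>c u\<close> is
  the choice behind the transition at \<open>u\<close>.\<close>

lemma strategy_nd_run:
  assumes "strategy_accepts t c"
  shows "\<exists>\<tau>. accepting_nd_run x NP NcF (simulation e) t \<tau>"
proof -
  let ?S = "\<lambda>u. fst (state c u)"
  have dnf: "\<And>u. \<forall>q \<in> ?S u. c u q \<in> dnf (\<delta> q)"
    and sat: "\<And>u. satisfies t u (lits (c u) (?S u)) (constrs (c u) (?S u))"
    and branch: "\<And>\<beta>. \<exists>\<^sub>\<infinity>n. snd (state c (path_node \<beta> n)) = {}"
    and csp: "csp_consistent x (csp UNIV (\<lambda>u. constrs (c u) (?S u)))"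
    using assms by (auto simp: strategy_accepts_def)
  have S_Q: "?S u \<subseteq> Q" for u
    using dnf by (intro state_subset) blast
  have pairs: "state c u \<in> breakpoint_pairs" for u
    using S_Q breakpoint_snd_subset[of F q0 c u] by (auto simp: breakpoint_pairs_def case_prod_beta)
  define \<tau> where "\<tau> u = (e (state c u), lits (c u) (?S u), constrs (c u) (?S u))" for u
  have "range \<tau> \<subseteq> nd_states (simulation e) \<times> consistent_lits NP \<times> Pow (Constr x NcF)"
    using pairs constrs_subset[OF S_Q dnf] satisfies_consistent_lits[OF sat lits_subset[OF S_Q dnf]]
    by (auto simp: \<tau>_def simulation_def)
  moreover have "\<exists>(L, X, qs) \<in> nd_delta (simulation e) (fst (\<tau> u)).
      snd (\<tau> u) = (L, X) \<and> (\<forall>d. fst (\<tau> (u @ [d])) = qs d) \<and> satisfies t u L X" for u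
    using dnf sat
    by (intro bexI[of _ "(lits (c u) (?S u), constrs (c u) (?S u),
          \<lambda>d. e (breakpoint_step F (c u) d (state c u)))"])
      (auto simp: \<tau>_def nd_delta_simulation[OF pairs] breakpoint_snoc)
  ultimately have "is_nd_run x NP NcF (simulation e) t \<tau>"
    unfolding is_nd_run_def by (simp add: \<tau>_def simulation_def breakpoint_Nil)
  moreover have "nd_branch_accepting (simulation e) \<tau> \<beta>" for \<beta>
    using infinitely_often_nd_accepting[of "\<lambda>n. state c (path_node \<beta> n)"] pairs branch
    by (simp add: nd_branch_accepting_def \<tau>_def)
  moreover have "csp_consistent x (csp UNIV (\<lambda>u. snd (snd (\<tau> u))))"
    using csp by (simp add: \<tau>_def)
  ultimately show ?thesis
    unfolding accepting_nd_run_def by blast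
qed

text \<open>Each transition of the simulation stems from some choice function; collected over all
  nodes these form the strategy. By induction on the node and injectivity of \<open>e\<close>, its
  breakpoint pairs are the ones coded by the run, so the acceptance conditions agree.\<close>

lemma nd_run_strategy:
  assumes "accepting_nd_run x NP NcF (simulation e) t \<tau>"
  shows "\<exists>c. strategy_accepts t c"
proof -
  have run: "is_nd_run x NP NcF (simulation e) t \<tau>"
    and branch: "\<And>\<beta>. nd_branch_accepting (simulation e) \<tau> \<beta>"
    and csp: "csp_consistent x (csp UNIV (\<lambda>u. snd (snd (\<tau> u))))"
    using assms by (auto simp: accepting_nd_run_def)
  have "range \<tau> \<subseteq> nd_states (simulation e) \<times> consistent_lits NP \<times> Pow (Constr x NcF)"
    using run unfolding is_nd_run_def by (elim conjE)
  then have "fst (\<tau> u) \<in> nd_states (simulation e)" for u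
    by (simp add: image_subset_iff mem_Times_iff)
  then have "\<forall>u. \<exists>p. p \<in> breakpoint_pairs \<and> fst (\<tau> u) = e p"
    by (simp add: simulation_def image_iff Bex_def)
  then obtain p where p: "\<And>u. p u \<in> breakpoint_pairs" "\<And>u. fst (\<tau> u) = e (p u)"
    by metis
  have "\<exists>c. (\<forall>q \<in> fst (p u). c q \<in> dnf (\<delta> q)) \<and> snd (\<tau> u) = (lits c (fst (p u)), constrs c (fst (p u))) \<and>
      (\<forall>d. fst (\<tau> (u @ [d])) = e (breakpoint_step F c d (p u))) \<and>
      satisfies t u (lits c (fst (p u))) (constrs c (fst (p u)))" for u
  proof -
    have "\<exists>(L, X, qs) \<in> nd_delta (simulation e) (fst (\<tau> u)).
        snd (\<tau> u) = (L, X) \<and> (\<forall>d. fst (\<tau> (u @ [d])) = qs d) \<and> satisfies t u L X"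
      using run unfolding is_nd_run_def by (elim conjE allE)
    then show ?thesis
      unfolding p(2)[of u] nd_delta_simulation[OF p(1)] by auto
  qed
  then obtain c where dnf: "\<And>u. \<forall>q \<in> fst (p u). c u q \<in> dnf (\<delta> q)"
    and label: "\<And>u. snd (\<tau> u) = (lits (c u) (fst (p u)), constrs (c u) (fst (p u)))"
    and succ: "\<And>u d. fst (\<tau> (u @ [d])) = e (breakpoint_step F (c u) d (p u))"
    and sat: "\<And>u. satisfies t u (lits (c u) (fst (p u))) (constrs (c u) (fst (p u)))"
    by metis
  have "state c u = p u" for u
  proof (induction u rule: rev_induct)
    case Nil
    have "e (p []) = e (breakpoint_init F q0)"
      using run p(2)[of "[]"] by (simp add: is_nd_run_def simulation_def)
    then show ?case
      using inj p(1) breakpoint_init_pairs by (simp add: breakpoint_Nil inj_on_eq_iff)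
  next
    case (snoc d u)
    have "e (p (u @ [d])) = e (breakpoint_step F (c u) d (p u))"
      using succ p(2) by metis
    then show ?case
      using inj p(1) breakpoint_step_pairs[OF p(1) dnf] snoc
      by (simp add: breakpoint_snoc inj_on_eq_iff)
  qed
  moreover have "\<exists>\<^sub>\<infinity>n. snd (p (path_node \<beta> n)) = {}" for \<beta>
    using branch[of \<beta>] infinitely_often_nd_accepting[of "\<lambda>n. p (path_node \<beta> n)"] p
    by (simp add: nd_branch_accepting_def)
  ultimately have "strategy_accepts t c"
    using dnf sat csp by (simp add: strategy_accepts_def label)
  then show ?thesis
    by blast
qed

lemma nd_language_simulation: "nd_language x NP NcF (simulation e) = alt_language x NP NcF A"
  unfolding alt_language_strategy nd_language_def
  using strategy_nd_run nd_run_strategy by blast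

end

end

theorem corollary1:
  fixes x :: "'o spatial_algebra"
    and NP :: "'a set"
    and NcF :: "'f set"
    and A :: "('d :: finite, 'a, 'o, 'f, 'q) alternating_automaton"
  assumes "spatial_relation_algebra x"
    and "finite NcF"
    and "buchi_alternating_automaton x NP NcF A"
  shows "\<exists>B :: ('d, 'a, 'o, 'f, nat) nondet_automaton.
    buchi_nondet_automaton x NP NcF B \<and>
    nd_language x NP NcF B = alt_language x NP NcF A \<and>
    real (card (nd_states B)) \<le>
      (2 / 3) ^ card (alt_accepting A) * 3 ^ card (alt_states A) + 1"
proof -
  interpret alternating x NP NcF A
    by standard (fact assms(3))
  \<comment> \<open>The statement asks for states of type \<open>nat\<close>, so the finitely many
    pairs are numbered.\<close>
  obtain e :: "'q set \<times> 'q set \<Rightarrow> nat" where e: "inj_on e breakpoint_pairs"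
    using finite_imp_inj_to_nat_seg[OF finite_breakpoint_pairs] by blast
  have "card (nd_states (simulation e)) = card breakpoint_pairs"
    using e by (simp add: simulation_def card_image)
  then show ?thesis
    using buchi_simulation[OF e] nd_language_simulation[OF e] card_breakpoint_pairs_le
    by (intro exI[of _ "simulation e"]) simp
qed

end
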